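(* Let $\phi:\mathbb{R}^q\to\mathbb{R}^q$ act componentwise and satisfy $|\phi(r)-\phi(s)|\le|r-s|$ for all $r,s\in\mathbb{R}^q$ (componentwise), and let $0\le\kappa<1$. Consider any training procedure producing controller parameters $(W,U,V,K,b,d)$ in which every update is followed by the projection $$W\leftarrow\Pi_\kappa(W),\qquad\Pi_\kappa(W):=\operatorname*{arg\,min}_{\|\bar W\|_\infty\le\kappa}\|\bar W-W\|_F.$$ Then every controller produced during training is well posed, i.e. for every $c\in\mathbb{R}^q$ the equation $\eta=\phi(W\eta+c)$ has a unique solution. In particular, for every measurement $y\in\mathbb{R}^p$, the fixed point $\eta=\phi(W\eta+Uy+b)$ is unique.
   Context: For a matrix $M$, $\|M\|_\infty=\max_i\sum_j|M_{ij}|$ and $\|M\|_F$ is the Frobenius norm. $W\in\mathbb{R}^{q\times q}$, $U\in\mathbb{R}^{q\times p}$, $b\in\mathbb{R}^q$ are parameters of a static implicit controller $\eta=\phi(W\eta+Uy+b)$, $u=Ky+V\eta+d$. "Acts componentwise" means $\phi(r)_i=\phi_i(r_i)$ for scalar functions $\phi_i$. *)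

theory Defs
  imports "HOL-Analysis.Analysis"
begin

definition inf_norm :: "real ^ 'n ^ 'm \<Rightarrow> real" where
  "inf_norm M = (MAX i. \<Sum>j\<in>UNIV. \<bar>M $ i $ j\<bar>)"

definition frobenius_norm :: "real ^ 'n ^ 'm \<Rightarrow> real" where
  "frobenius_norm M = sqrt (\<Sum>i\<in>UNIV. \<Sum>j\<in>UNIV. (M $ i $ j)\<^sup>2)"

definition inf_proj :: "real \<Rightarrow> real ^ 'q ^ 'q \<Rightarrow> real ^ 'q ^ 'q" where
  "inf_proj \<kappa> W = (ARG_MIN (\<lambda>V. frobenius_norm (V - W)) V. inf_norm V \<le> \<kappa>)"

definition acts_componentwise :: "(real ^ 'q \<Rightarrow> real ^ 'q) \<Rightarrow> bool" where
  "acts_componentwise \<phi> \<longleftrightarrow> (\<exists>f. \<forall>r i. \<phi> r $ i = f i (r $ i))"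

definition componentwise_nonexpansive :: "(real ^ 'q \<Rightarrow> real ^ 'q) \<Rightarrow> bool" where
  "componentwise_nonexpansive \<phi> \<longleftrightarrow>
     (\<forall>r s i. \<bar>\<phi> r $ i - \<phi> s $ i\<bar> \<le> \<bar>r $ i - s $ i\<bar>)"

text \<open>Parameters of the static implicit controller
  \<open>\<eta> = \<phi> (W \<eta> + U y + b)\<close>, \<open>u = K y + V \<eta> + d\<close>, where the measurement \<open>y\<close>, the
  implicit variable \<open>\<eta>\<close> and the control input \<open>u\<close> are indexed by \<open>'p\<close>, \<open>'q\<close> and \<open>'m\<close>.\<close>

record ('p::finite, 'q::finite, 'm::finite) controller =
  ctrl_W :: "real ^ 'q ^ 'q"
  ctrl_U :: "real ^ 'p ^ 'q"
  ctrl_V :: "real ^ 'q ^ 'm"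
  ctrl_K :: "real ^ 'p ^ 'm"
  ctrl_b :: "real ^ 'q"
  ctrl_d :: "real ^ 'm"

definition well_posed ::
  "(real ^ 'q \<Rightarrow> real ^ 'q) \<Rightarrow> ('p::finite, 'q::finite, 'm::finite) controller \<Rightarrow> bool" where
  "well_posed \<phi> \<theta> \<longleftrightarrow> (\<forall>c. \<exists>!\<eta>. \<eta> = \<phi> (ctrl_W \<theta> *v \<eta> + c))"

definition project_controller ::
  "real \<Rightarrow> ('p::finite, 'q::finite, 'm::finite) controller \<Rightarrow> ('p, 'q, 'm) controller" where
  "project_controller \<kappa> \<theta> = \<theta>\<lparr>ctrl_W := inf_proj \<kappa> (ctrl_W \<theta>)\<rparr>"

text \<open>A training procedure is an arbitrary relation \<open>upd\<close> between the controllers seen so far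
  (initial one first) and the possible results of the next raw update; being a relation, it also
  covers randomness, data and internal optimizer state. \<open>training_run \<kappa> upd \<theta>\<^sub>0 h\<close> says that \<open>h\<close>
  lists the controllers produced by finitely many updates, each followed by the projection. The
  initial controller \<open>\<theta>\<^sub>0\<close> is arbitrary and is not a member of \<open>h\<close> on its own account.\<close>

inductive training_run ::
  "real \<Rightarrow>
   (('p::finite, 'q::finite, 'm::finite) controller list \<Rightarrow> ('p, 'q, 'm) controller \<Rightarrow> bool) \<Rightarrow>
   ('p, 'q, 'm) controller \<Rightarrow> ('p, 'q, 'm) controller list \<Rightarrow> bool"
  for \<kappa> upd \<theta>\<^sub>0 where
  start: "training_run \<kappa> upd \<theta>\<^sub>0 []"
| update: "training_run \<kappa> upd \<theta>\<^sub>0 h \<Longrightarrow> upd (\<theta>\<^sub>0 # h) \<theta>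
    \<Longrightarrow> training_run \<kappa> upd \<theta>\<^sub>0 (h @ [project_controller \<kappa> \<theta>])"

definition produced_by_training ::
  "real \<Rightarrow>
   (('p::finite, 'q::finite, 'm::finite) controller list \<Rightarrow> ('p, 'q, 'm) controller \<Rightarrow> bool) \<Rightarrow>
   ('p, 'q, 'm) controller \<Rightarrow> ('p, 'q, 'm) controller \<Rightarrow> bool" where
  "produced_by_training \<kappa> upd \<theta>\<^sub>0 \<theta> \<longleftrightarrow> (\<exists>h. training_run \<kappa> upd \<theta>\<^sub>0 h \<and> \<theta> \<in> set h)"

end

theory Submission
  imports Defs
begin

text \<open>The constraint set of the projection is nonempty and closed and the Frobenius norm is the
  Euclidean norm, so the minimum is attained and every projected \<open>W\<close> has row sums at most
  \<open>\<kappa>\<close>. Hence \<open>\<eta> \<mapsto> \<phi> (W \<eta> + c)\<close> contracts the sup norm by \<open>\<kappa> < 1\<close>. Since the sup norm is not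
  the norm of the type \<open>real ^ 'q\<close>, existence of the fixed point comes from Brouwer's theorem on a
  large sup-norm ball instead of Banach's theorem.\<close>

lemma frobenius_norm_eq_norm: "frobenius_norm M = norm M"
  unfolding frobenius_norm_def norm_vec_def L2_set_def
  by (simp add: sum_nonneg)

lemma inf_norm_le_iff: "inf_norm M \<le> k \<longleftrightarrow> (\<forall>i. (\<Sum>j\<in>UNIV. \<bar>M $ i $ j\<bar>) \<le> k)"
  unfolding inf_norm_def by (subst Max_le_iff) auto

text \<open>\<open>ARG_MIN\<close> is a choice operator, so feasibility of its value is known only
  once some minimizer exists. A nearest point of the closed constraint set, nonempty since it
  contains \<open>0\<close>, is such a minimizer.\<close>

lemma inf_norm_inf_proj_le:
  assumes "0 \<le> \<kappa>"
  shows "inf_norm (inf_proj \<kappa> W) \<le> \<kappa>"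
proof -
  let ?S = "{V :: real ^ 'a ^ 'a. inf_norm V \<le> \<kappa>}"
  have "closed ?S"
    unfolding inf_norm_le_iff
    by (intro closed_Collect_all closed_Collect_le continuous_intros)
  moreover have "0 \<in> ?S"
    using assms by (simp add: inf_norm_le_iff)
  then have "?S \<noteq> {}"
    by (metis empty_iff)
  ultimately obtain V where "V \<in> ?S" "\<And>V'. V' \<in> ?S \<Longrightarrow> dist W V \<le> dist W V'"
    using distance_attains_inf[of ?S W] by metis
  then have "is_arg_min (\<lambda>V. frobenius_norm (V - W)) (\<lambda>V. inf_norm V \<le> \<kappa>) V"
    by (simp add: is_arg_min_linorder frobenius_norm_eq_norm dist_norm norm_minus_commute)
  then have "is_arg_min (\<lambda>V. frobenius_norm (V - W)) (\<lambda>V. inf_norm V \<le> \<kappa>) (inf_proj \<kappa> W)"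
    unfolding inf_proj_def arg_min_def by (rule someI)
  then show ?thesis
    by (simp add: is_arg_min_def)
qed

lemma infnorm_le_cart_iff: "infnorm (x :: real ^ 'n) \<le> k \<longleftrightarrow> (\<forall>i. \<bar>x $ i\<bar> \<le> k)"
  unfolding infnorm_cart by (subst cSup_le_iff) (auto simp: full_SetCompr_eq)

text \<open>Bounding each coordinate of \<open>x\<close> by \<open>infnorm x\<close> leaves the row
  sums of \<open>M\<close>; thus \<open>inf_norm\<close> dominates the operator norm induced by
  \<open>infnorm\<close>.\<close>

lemma infnorm_matrix_vector_mult_le: "infnorm (M *v x) \<le> inf_norm M * infnorm x"
  unfolding infnorm_le_cart_iff
proof
  fix i
  have "\<bar>(M *v x) $ i\<bar> \<le> (\<Sum>j\<in>UNIV. \<bar>M $ i $ j * x $ j\<bar>)"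
    unfolding matrix_vector_mult_def by simp
  also have "\<dots> \<le> (\<Sum>j\<in>UNIV. \<bar>M $ i $ j\<bar> * infnorm x)"
    by (intro sum_mono) (simp add: abs_mult mult_left_mono component_le_infnorm_cart)
  \<comment> \<open>Taking \<open>inf_norm M\<close> itself as the bound \<open>k\<close> turns the
    equivalence into the row sum estimate.\<close>
  also have "\<dots> \<le> inf_norm M * infnorm x"
    unfolding sum_distrib_right[symmetric]
    using inf_norm_le_iff[of M "inf_norm M"] by (intro mult_right_mono infnorm_pos_le) auto
  finally show "\<bar>(M *v x) $ i\<bar> \<le> inf_norm M * infnorm x" .
qed

text \<open>\<open>infnorm\<close> and the Euclidean norm are equivalent, so the ball is compact and
  \<open>f\<close> continuous in the topology of the type, as Brouwer's theorem requires. The factor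
  \<open>k < 1\<close> then forces uniqueness.\<close>

lemma infnorm_contraction_ex1_fixpoint:
  fixes f :: "'a::euclidean_space \<Rightarrow> 'a"
  assumes contr: "\<And>x y. infnorm (f x - f y) \<le> k * infnorm (x - y)"
    and k: "0 \<le> k" "k < 1"
  shows "\<exists>!x. x = f x"
proof -
  \<comment> \<open>The radius at which the bound \<open>infnorm (f 0) + k * R\<close> on the image
    of the ball equals \<open>R\<close> again.\<close>
  define R where "R = infnorm (f 0) / (1 - k)"
  let ?S = "{x :: 'a. infnorm x \<le> R}"
  have R: "infnorm (f 0) + k * R = R"
    using k by (simp add: R_def field_simps)
  have "0 \<le> R"
    using k by (simp add: R_def infnorm_pos_le)
  have "compact ?S"
  proof (rule compact_eq_bounded_closed[THEN iffD2, OF conjI])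
    show "bounded ?S"
      unfolding bounded_iff
    proof (intro exI ballI)
      fix x assume "x \<in> ?S"
      then show "norm x \<le> sqrt DIM('a) * R"
        by (intro order_trans[OF norm_le_infnorm] mult_left_mono) auto
    qed
    show "closed ?S"
      by (intro closed_Collect_le continuous_intros)
  qed
  moreover have "convex ?S"
  proof (rule convexI)
    fix x y and u v :: real
    assume "x \<in> ?S" "y \<in> ?S" and uv: "0 \<le> u" "0 \<le> v" "u + v = 1"
    then have "u * infnorm x + v * infnorm y \<le> R"
      by (intro convex_bound_le) auto
    then show "u *\<^sub>R x + v *\<^sub>R y \<in> ?S"
      using infnorm_triangle[of "u *\<^sub>R x" "v *\<^sub>R y"] uv by (simp add: infnorm_mul)
  qed
  moreover have "?S \<noteq> {}"
    using \<open>0 \<le> R\<close> by (auto simp: infnorm_0 intro!: exI[of _ 0])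
  moreover have "continuous_on ?S f"
  proof -
    \<comment> \<open>The factor \<open>sqrt DIM('a)\<close> is the cost of passing to the Euclidean
      norm; the product with \<open>k\<close> may exceed 1, so only continuity is drawn from
      it.\<close>
    have "norm (f x - f y) \<le> sqrt DIM('a) * k * norm (x - y)" for x y
    proof -
      have "norm (f x - f y) \<le> sqrt DIM('a) * infnorm (f x - f y)"
        by (rule norm_le_infnorm)
      also have "\<dots> \<le> sqrt DIM('a) * (k * norm (x - y))"
        using k by (intro mult_left_mono order_trans[OF contr] infnorm_le_norm) auto
      finally show ?thesis
        by (simp add: mult.assoc)
    qed
    then have "(sqrt DIM('a) * k)-lipschitz_on ?S f"
      using k by (intro lipschitz_onI) (auto simp: dist_norm)
    then show ?thesis
      by (rule lipschitz_on_continuous_on)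
  qed
  moreover have "f \<in> ?S \<rightarrow> ?S"
  proof
    fix x assume "x \<in> ?S"
    then have "k * infnorm x \<le> k * R"
      using k by (simp add: mult_left_mono)
    \<comment> \<open>Split \<open>f x\<close> as \<open>(f x - f 0) + f 0\<close> and apply the
      equation for \<open>R\<close>.\<close>
    then show "f x \<in> ?S"
      using contr[of x 0] infnorm_triangle[of "f x - f 0" "f 0"] R by simp
  qed
  ultimately obtain x where fx: "f x = x"
    by (rule brouwer) blast
  have uniq: "y = x" if "y = f y" for y
  proof -
    have "infnorm (y - x) \<le> k * infnorm (y - x)"
      using contr[of y x] that fx by simp
    then have "(1 - k) * infnorm (y - x) \<le> 0"
      by (simp add: algebra_simps)
    then have "infnorm (y - x) \<le> 0"
      using k by (simp add: mult_le_0_iff)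
    then show ?thesis
      using infnorm_pos_le[of "y - x"] infnorm_eq_0[of "y - x"] by simp
  qed
  show ?thesis
  proof
    show "x = f x"
      using fx by (rule sym)
  qed (rule uniq)
qed

lemma infnorm_componentwise_nonexpansive:
  assumes "componentwise_nonexpansive \<phi>"
  shows "infnorm (\<phi> r - \<phi> s) \<le> infnorm (r - s)"
  unfolding infnorm_le_cart_iff
proof
  fix i
  have "\<bar>(\<phi> r - \<phi> s) $ i\<bar> \<le> \<bar>(r - s) $ i\<bar>"
    using assms by (simp add: componentwise_nonexpansive_def)
  also have "\<dots> \<le> infnorm (r - s)"
    by (rule component_le_infnorm_cart)
  finally show "\<bar>(\<phi> r - \<phi> s) $ i\<bar> \<le> infnorm (r - s)" .
qed

lemma well_posed_if_inf_norm_le: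
  assumes "componentwise_nonexpansive \<phi>"
    and "inf_norm (ctrl_W \<theta>) \<le> \<kappa>" "0 \<le> \<kappa>" "\<kappa> < 1"
  shows "well_posed \<phi> \<theta>"
  unfolding well_posed_def
proof (intro allI infnorm_contraction_ex1_fixpoint)
  fix c x y
  let ?W = "ctrl_W \<theta>"
  \<comment> \<open>The shift \<open>c\<close> cancels in the difference of the arguments.\<close>
  have "infnorm (\<phi> (?W *v x + c) - \<phi> (?W *v y + c)) \<le> infnorm (?W *v (x - y))"
    using infnorm_componentwise_nonexpansive[OF assms(1), of "?W *v x + c" "?W *v y + c"]
    by (simp add: matrix_vector_mult_diff_distrib)
  also have "\<dots> \<le> inf_norm ?W * infnorm (x - y)"
    by (rule infnorm_matrix_vector_mult_le)
  also have "\<dots> \<le> \<kappa> * infnorm (x - y)"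
    using assms(2) by (intro mult_right_mono infnorm_pos_le)
  finally show "infnorm (\<phi> (?W *v x + c) - \<phi> (?W *v y + c)) \<le> \<kappa> * infnorm (x - y)" .
qed (use assms in auto)

text \<open>Every entry of \<open>h\<close> is an output of the projection, whatever raw update came
  before. The list starts empty, so the arbitrary \<open>\<theta>\<^sub>0\<close> need not satisfy
  the bound.\<close>

lemma training_run_inf_norm_le:
  assumes "training_run \<kappa> upd \<theta>\<^sub>0 h" "0 \<le> \<kappa>" "\<theta> \<in> set h"
  shows "inf_norm (ctrl_W \<theta>) \<le> \<kappa>"
  using assms
  by (induction rule: training_run.induct) (auto simp: project_controller_def inf_norm_inf_proj_le)

theorem proposition1:
  fixes \<phi> :: "real ^ 'q \<Rightarrow> real ^ 'q"
    and \<kappa> :: real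
    and upd :: "('p::finite, 'q::finite, 'm::finite) controller list
                  \<Rightarrow> ('p, 'q, 'm) controller \<Rightarrow> bool"
    and \<theta>\<^sub>0 :: "('p, 'q, 'm) controller"
  assumes "acts_componentwise \<phi>"
    and "componentwise_nonexpansive \<phi>"
    and "0 \<le> \<kappa>" and "\<kappa> < 1"
  shows "\<forall>\<theta>. produced_by_training \<kappa> upd \<theta>\<^sub>0 \<theta> \<longrightarrow>
           well_posed \<phi> \<theta> \<and>
           (\<forall>y. \<exists>!\<eta>. \<eta> = \<phi> (ctrl_W \<theta> *v \<eta> + ctrl_U \<theta> *v y + ctrl_b \<theta>))"
proof (intro allI impI)
  fix \<theta>
  assume "produced_by_training \<kappa> upd \<theta>\<^sub>0 \<theta>"
  then have wp: "well_posed \<phi> \<theta>"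
    using assms training_run_inf_norm_le well_posed_if_inf_norm_le
    unfolding produced_by_training_def by metis
  then show "well_posed \<phi> \<theta> \<and>
      (\<forall>y. \<exists>!\<eta>. \<eta> = \<phi> (ctrl_W \<theta> *v \<eta> + ctrl_U \<theta> *v y + ctrl_b \<theta>))"
    \<comment> \<open>Reassociating the sum exhibits the controller equation as the case
      \<open>c = ctrl_U \<theta> *v y + ctrl_b \<theta>\<close>.\<close>
    unfolding well_posed_def add.assoc by simp
qed

end
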